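(* $${}_2F_1\left(\tfrac13,\tfrac23;\tfrac56;\tfrac{27}{32}\right)=\frac85.$$
   Context: For complex $a,b,c$ with $c\notin\{0,-1,-2,\dots\}$ and $|x|<1$, ${}_2F_1(a,b;c;x)=\sum_{n\ge 0}\frac{(a,n)(b,n)}{(c,n)(1,n)}x^n$ denotes Gauss's hypergeometric series, where $(\alpha,n)=\alpha(\alpha+1)\cdots(\alpha+n-1)$, $(\alpha,0)=1$. *)

theory Defs
  imports "HOL-Analysis.Analysis"
begin

definition hypergeom_2F1 :: "complex \<Rightarrow> complex \<Rightarrow> complex \<Rightarrow> complex \<Rightarrow> complex" where
  "hypergeom_2F1 a b c x =
     (\<Sum>n. pochhammer a n * pochhammer b n / (pochhammer c n * pochhammer 1 n) * x ^ n)"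

text \<open>
  The sum operator is unspecified on divergent series; the following fact shows that the
  definition is meaningful on the whole domain \<open>\<bar>x\<bar> < 1\<close>, \<open>c \<notin> {0, -1, -2, \<dots>}\<close>.
\<close>

lemma summable_hypergeom_2F1:
  fixes a b c x :: complex
  assumes c: "c \<notin> \<int>\<^sub>\<le>\<^sub>0" and x: "norm x < 1"
  shows "summable (\<lambda>n. pochhammer a n * pochhammer b n / (pochhammer c n * pochhammer 1 n) * x ^ n)"
    (is "summable ?f")
proof -
  define r where
    "r = (\<lambda>n. (a + of_nat n) * (b + of_nat n) / ((c + of_nat n) * (1 + of_nat n)) * x)"
  have step: "?f (Suc n) = r n * ?f n" for n
    by (simp add: r_def pochhammer_Suc field_simps)
  have lim: "(\<lambda>n. (d + of_nat n) / of_nat n) \<longlonglongrightarrow> 1" for d :: complex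
  proof -
    have "(\<lambda>n. d / of_nat n + 1) \<longlonglongrightarrow> 0 + 1"
      by (intro tendsto_add tendsto_const tendsto_divide_0[OF tendsto_const]
            tendsto_of_nat)
    moreover have "eventually (\<lambda>n. d / of_nat n + 1 = (d + of_nat n) / of_nat n) sequentially"
      using eventually_gt_at_top[of 0] by eventually_elim (simp add: field_simps)
    ultimately show ?thesis
      by (simp add: tendsto_cong)
  qed
  have "(\<lambda>n. ((a + of_nat n) / of_nat n) * ((b + of_nat n) / of_nat n) /
          (((c + of_nat n) / of_nat n) * ((1 + of_nat n) / of_nat n)) * x)
        \<longlonglongrightarrow> 1 * 1 / (1 * 1) * x"
    by (intro tendsto_mult tendsto_divide lim tendsto_const) auto
  moreover have "eventually (\<lambda>n. ((a + of_nat n) / of_nat n) * ((b + of_nat n) / of_nat n) /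
          (((c + of_nat n) / of_nat n) * ((1 + of_nat n) / of_nat n)) * x = r n) sequentially"
    using eventually_gt_at_top[of 0] by eventually_elim (simp add: r_def)
  ultimately have "r \<longlonglongrightarrow> x"
    by (simp add: tendsto_cong)
  then have "(\<lambda>n. norm (r n)) \<longlonglongrightarrow> norm x"
    by (rule tendsto_norm)
  moreover obtain q where q: "norm x < q" "q < 1"
    using dense[OF x] by blast
  ultimately have "eventually (\<lambda>n. norm (r n) < q) sequentially"
    by (intro order_tendstoD)
  then obtain N where N: "\<And>n. n \<ge> N \<Longrightarrow> norm (r n) < q"
    by (auto simp: eventually_sequentially)
  have "norm (?f (Suc n)) \<le> q * norm (?f n)" if "n \<ge> N" for n
    unfolding step norm_mult[of "r n"]
    using N[OF that] by (intro mult_right_mono) auto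
  with q(2) show ?thesis
    by (rule summable_ratio_test)
qed

end

(*
  With t = 1 - w^2, Euler's integral for 2F1(1/3, 2/3; 5/6; 27/32) becomes a constant times the
  integral of ((1 - w^2) (27 w^2 + 5))^(-2/3) over 0 < w < 1, a period of an abelian surface
  which at this parameter maps onto the elliptic curve x^3 = 1 - y^2. A rational function y of w
  with A, B cubic in w and 1 - y^2 = (1 - w^2) (A B)^3 / (128 w^3 (27 w^2 + 5))^2 pulls the form
  (1 - y^2)^(-2/3) dy back to the integrand. As w runs from 0 to 1, y runs from minus
  infinity to 1; the parts y < -1 and y > -1 both contribute Beta (1/2) (1/3), the former by the
  reflection formula at 1/6. Dividing by Beta (1/3) (1/2) leaves 8/5.
*)

theory Submission
  imports Defs
begin

section \<open>Euler's integral\<close>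

text \<open>With real parameters every term is real, so the complex series is the embedding of a
  real one. This moves the whole evaluation to real integrals.\<close>

lemma hypergeom_2F1_sums_of_real:
  fixes a b c x :: real
  assumes "c > 0" and "\<bar>x\<bar> < 1"
  obtains s where
    "(\<lambda>n. pochhammer a n * pochhammer b n / (pochhammer c n * fact n) * x ^ n) sums s"
    "hypergeom_2F1 (of_real a) (of_real b) (of_real c) (of_real x) = of_real s"
proof -
  let ?f = "\<lambda>n. pochhammer a n * pochhammer b n / (pochhammer c n * fact n) * x ^ n"
  let ?F = "\<lambda>n. pochhammer (of_real a) n * pochhammer (of_real b) n /
              (pochhammer (of_real c) n * pochhammer 1 n) * (of_real x :: complex) ^ n"
  have eq: "?F = (\<lambda>n. of_real (?f n))"
    by (simp add: fun_eq_iff pochhammer_of_real pochhammer_fact[symmetric])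
  have "complex_of_real c \<notin> \<int>\<^sub>\<le>\<^sub>0"
    using assms(1) nonpos_Ints_nonpos[of c] by (auto simp: of_real_in_nonpos_Ints_iff)
  then have "summable ?F"
    using assms(2) by (intro summable_hypergeom_2F1) auto
  then have "summable ?f"
    by (simp only: eq summable_of_real_iff)
  then have "?f sums suminf ?f"
    by (rule summable_sums)
  moreover have "hypergeom_2F1 (of_real a) (of_real b) (of_real c) (of_real x) = of_real (suminf ?f)"
    unfolding hypergeom_2F1_def eq using \<open>summable ?f\<close> by (rule suminf_of_real[symmetric])
  ultimately show thesis
    by (rule that)
qed

text \<open>Shifting by \<open>n\<close> multiplies \<open>Gamma a\<close> and
  \<open>Gamma (a + b)\<close> by Pochhammer symbols. Moments of the Beta density thus produce the
  ratio \<open>pochhammer a n / pochhammer c n\<close> of the hypergeometric coefficients.\<close>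

lemma Beta_add_of_nat:
  fixes a b :: real
  assumes "a > 0" "b > 0"
  shows "Beta (a + of_nat n) b = pochhammer a n / pochhammer (a + b) n * Beta a b"
proof -
  have nz: "a \<notin> \<int>\<^sub>\<le>\<^sub>0" "a + b \<notin> \<int>\<^sub>\<le>\<^sub>0" "a + of_nat n \<notin> \<int>\<^sub>\<le>\<^sub>0" "a + b + of_nat n \<notin> \<int>\<^sub>\<le>\<^sub>0"
    using assms by (auto elim!: nonpos_Ints_cases)
  show ?thesis
    using nz by (simp add: Beta_def pochhammer_Gamma Gamma_eq_zero_iff add_ac)
qed

text \<open>Expand \<open>(1 - x * t) powr (-b)\<close> by the binomial series and integrate term by
  term. Since \<open>x\<close> and \<open>b\<close> are nonnegative, so are all terms, and monotone
  convergence justifies the exchange.\<close>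

lemma has_integral_Euler_2F1:
  fixes a b c x s :: real
  assumes "0 < a" "a < c" "0 < b" "0 \<le> x" "x < 1"
    and s: "(\<lambda>n. pochhammer a n * pochhammer b n / (pochhammer c n * fact n) * x ^ n) sums s"
  shows "((\<lambda>t. t powr (a - 1) * (1 - t) powr (c - a - 1) * (1 - x * t) powr (-b))
           has_integral Beta a (c - a) * s) {0<..<1}"
proof -
  define u where "u n t = t powr (a - 1) * (1 - t) powr (c - a - 1) *
                    (pochhammer b n / fact n * (x * t) ^ n)" for n t
  have "((\<lambda>t. \<Sum>n<k. u n t) has_integral
          (\<Sum>n<k. Beta a (c - a) * (pochhammer a n * pochhammer b n / (pochhammer c n * fact n) * x ^ n)))
          {0<..<1}" for k
  proof (intro has_integral_sum finite_lessThan)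
    fix n :: nat
    have "((\<lambda>t. t powr (a + n - 1) * (1 - t) powr (c - a - 1)) has_integral Beta (a + n) (c - a)) {0<..<1}"
      using has_integral_Beta_real[of "a + n" "c - a"] assms by (simp add: has_integral_Icc_iff_Ioo)
    from has_integral_mult_right[OF this, of "pochhammer b n / fact n * x ^ n"]
    have "((\<lambda>t. pochhammer b n / fact n * x ^ n * (t powr (a + n - 1) * (1 - t) powr (c - a - 1)))
       has_integral Beta a (c - a) * (pochhammer a n * pochhammer b n / (pochhammer c n * fact n) * x ^ n)) {0<..<1}"
      using assms by (simp add: Beta_add_of_nat field_simps)
    then show "(u n has_integral
        Beta a (c - a) * (pochhammer a n * pochhammer b n / (pochhammer c n * fact n) * x ^ n)) {0<..<1}"
    proof (rule has_integral_eq[rotated])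
      fix t :: real assume "t \<in> {0<..<1}"
      then have "t powr (a + n - 1) = t powr (a - 1) * t ^ n"
        by (simp add: powr_realpow[symmetric] powr_add[symmetric] add_ac add_diff_eq)
      then show "pochhammer b n / fact n * x ^ n * (t powr (a + n - 1) * (1 - t) powr (c - a - 1)) = u n t"
        by (simp add: u_def power_mult_distrib mult_ac)
    qed
  qed
  then show ?thesis
  proof (rule has_integral_monotone_convergence_increasing)
    fix k and t :: real assume t: "t \<in> {0<..<1}"
    show "(\<Sum>n<k. u n t) \<le> (\<Sum>n<Suc k. u n t)"
      using t assms by (simp add: u_def pochhammer_nonneg)
    have "x * t \<le> x * 1"
      using t assms by (intro mult_left_mono) auto
    then have "\<bar>- (x * t)\<bar> < 1"
      using t assms by simp
    \<comment> \<open>The signs from the exponent \<open>-b\<close> and from the argument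
      \<open>-(x * t)\<close> cancel, leaving
      \<open>pochhammer b n / fact n * (x * t) ^ n\<close>.\<close>
    from gen_binomial_real[OF this, of "-b"]
    have "(\<lambda>n. pochhammer b n / fact n * (x * t) ^ n) sums (1 - x * t) powr (-b)"
      by (simp add: gbinomial_pochhammer power_minus[of "x * t"] mult_ac
            power_mult_distrib[symmetric] flip: mult.assoc)
    then have "(\<lambda>n. u n t) sums (t powr (a - 1) * (1 - t) powr (c - a - 1) * (1 - x * t) powr (-b))"
      unfolding u_def by (rule sums_mult)
    then show "(\<lambda>k. \<Sum>n<k. u n t) \<longlonglongrightarrow> t powr (a - 1) * (1 - t) powr (c - a - 1) * (1 - x * t) powr (-b)"
      by (simp add: sums_def)
  next
    show "(\<lambda>k. \<Sum>n<k. Beta a (c - a) * (pochhammer a n * pochhammer b n / (pochhammer c n * fact n) * x ^ n))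
            \<longlonglongrightarrow> Beta a (c - a) * s"
      using sums_mult[OF s, of "Beta a (c - a)"] by (simp add: sums_def)
  qed
qed

section \<open>Change of variables and a relation between Beta values\<close>

text \<open>For nonnegative functions integrability and absolute integrability coincide, so the
  change of variables for absolutely integrable functions becomes an equivalence usable in both
  directions. The absolute value of \<open>g'\<close> also covers decreasing substitutions.\<close>

lemma has_integral_substitution_nonneg:
  fixes f g g' :: "real \<Rightarrow> real"
  assumes S: "open S"
    and der: "\<And>x. x \<in> S \<Longrightarrow> (g has_field_derivative g' x) (at x)"
    and inj: "inj_on g S" and im: "g ` S = T"
    and nonneg: "\<And>y. y \<in> T \<Longrightarrow> f y \<ge> 0"
    and F: "\<And>x. x \<in> S \<Longrightarrow> F x = \<bar>g' x\<bar> * f (g x)"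
  shows "(F has_integral I) S \<longleftrightarrow> (f has_integral I) T"
proof -
  have "(F has_integral I) S \<longleftrightarrow> ((\<lambda>x. \<bar>g' x\<bar> * f (g x)) has_integral I) S"
    using F by (rule has_integral_cong)
  also have "\<dots> \<longleftrightarrow> (\<lambda>x. \<bar>g' x\<bar> * f (g x)) absolutely_integrable_on S \<and>
           integral S (\<lambda>x. \<bar>g' x\<bar> * f (g x)) = I"
    using im nonneg by (subst absolutely_integrable_on_iff_nonneg) (auto simp: has_integral_iff)
  also have "\<dots> \<longleftrightarrow> f absolutely_integrable_on T \<and> integral T f = I"
    using has_absolute_integral_change_of_variables_1'[of S g g' f I] S inj im der
    by (auto intro: has_field_derivative_at_within)
  also have "\<dots> \<longleftrightarrow> (f has_integral I) T"
    using nonneg by (subst absolutely_integrable_on_iff_nonneg) (auto simp: has_integral_iff)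
  finally show ?thesis .
qed

text \<open>Reflection gives \<open>Gamma (1/6) * Gamma (5/6) = pi / sin (pi / 6) = 2 * pi\<close>,
  twice the square of \<open>Gamma (1/2)\<close>. Dividing and multiplying by
  \<open>Gamma (1/3)\<close> compares the two Beta values.\<close>

lemma Beta_sixth_third: "Beta (1/6) (1/3) = 2 * Beta (1/2) (1/3 :: real)"
proof -
  have "Gamma (1/6) * Gamma (5/6 :: real) = 2 * pi"
  proof -
    have "complex_of_real (Gamma (1/6) * Gamma (5/6)) = Gamma (of_real (1/6)) * Gamma (1 - of_real (1/6))"
      by (simp flip: Gamma_complex_of_real)
    also have "\<dots> = of_real pi / sin (of_real pi * of_real (1/6))"
      by (rule Gamma_reflection_complex)
    also have "\<dots> = of_real (pi / sin (pi / 6))"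
      by (simp flip: sin_of_real)
    finally show ?thesis
      unfolding of_real_eq_iff by (simp add: sin_30)
  qed
  moreover have "Gamma (1/2) * Gamma (1/2 :: real) = pi"
    by (simp add: Gamma_one_half_real)
  moreover have "p / q = 2 * (q / r)" if "p * r = 2 * pi" "q * q = pi" "q > 0" "r > 0" for p q r
    using that by (simp add: field_simps)
  ultimately have "Gamma (1/6) / Gamma (1/2) = 2 * (Gamma (1/2) / Gamma (5/6 :: real))"
    by simp
  then have "Gamma (1/6) / Gamma (1/2) * Gamma (1/3) = 2 * (Gamma (1/2) / Gamma (5/6)) * Gamma (1/3 :: real)"
    by simp
  then show ?thesis
    by (simp add: Beta_def mult_ac)
qed

section \<open>The elliptic integral and its covering\<close>

text \<open>Up to sign, the holomorphic differential \<open>dy / x^2\<close> on the elliptic curve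
  \<open>x^3 = 1 - y^2\<close>. The absolute value lets one density serve both for
  \<open>\<bar>y\<bar> < 1\<close> and for \<open>y < -1\<close>.\<close>

definition beta_density :: "real \<Rightarrow> real" where "beta_density y = \<bar>1 - y\<^sup>2\<bar> powr (-2/3)"

lemma beta_density_nonneg: "beta_density y \<ge> 0"
  by (simp add: beta_density_def)

lemma has_integral_Beta_half_third:
  "((\<lambda>v. v powr (-1/2) * (1 - v) powr (-2/3)) has_integral Beta (1/2) (1/3 :: real)) {0<..<1}"
  using has_integral_Beta_real[of "1/2" "1/3"] by (simp add: has_integral_Icc_iff_Ioo)

text \<open>On each half of the interval \<open>v = y^2\<close> turns twice the density into the
  Beta integrand; the two halves contribute equally.\<close>

lemma has_integral_beta_density_inner: "(beta_density has_integral Beta (1/2) (1/3)) {-1<..<1}"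
proof -
  let ?f = "\<lambda>v::real. v powr (-1/2) * (1 - v) powr (-2/3)"
  have sq: "2 * beta_density y = \<bar>2 * y\<bar> * ?f (y\<^sup>2)" if "y \<in> {-1<..<1}" "y \<noteq> 0" for y
  proof -
    have "y\<^sup>2 < 1"
      using that by (simp add: abs_square_less_1 abs_less_iff)
    moreover have "(y\<^sup>2) powr (-1/2) = 1 / \<bar>y\<bar>"
      using that by (simp add: powr_minus_divide powr_half_sqrt)
    ultimately show ?thesis
      using that by (simp add: beta_density_def abs_mult)
  qed
  have R: "((\<lambda>y. 2 * beta_density y) has_integral Beta (1/2) (1/3)) {0<..<1}
      \<longleftrightarrow> (?f has_integral Beta (1/2) (1/3)) {0<..<1}"
  proof (rule has_integral_substitution_nonneg)
    show "(\<lambda>y::real. y\<^sup>2) ` {0<..<1} = {0<..<1}"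
    proof (intro equalityI subsetI)
      fix v :: real assume "v \<in> {0<..<1}"
      then have "v = (sqrt v)\<^sup>2" "sqrt v \<in> {0<..<1}"
        by auto
      then show "v \<in> (\<lambda>y. y\<^sup>2) ` {0<..<1}"
        by blast
    qed (auto simp: power_less_one_iff)
    show "2 * beta_density y = \<bar>2 * y\<bar> * ?f (y\<^sup>2)" if "y \<in> {0<..<1}" for y
      using that by (intro sq) auto
  qed (auto intro!: derivative_eq_intros inj_onI)
  have L: "((\<lambda>y. 2 * beta_density y) has_integral Beta (1/2) (1/3)) {-1<..<0}
      \<longleftrightarrow> (?f has_integral Beta (1/2) (1/3)) {0<..<1}"
  proof (rule has_integral_substitution_nonneg)
    show "(\<lambda>y::real. y\<^sup>2) ` {-1<..<0} = {0<..<1}"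
    proof (intro equalityI subsetI)
      fix v :: real assume "v \<in> {0<..<1}"
      then have "v = (- sqrt v)\<^sup>2" "- sqrt v \<in> {-1<..<0}"
        by auto
      then show "v \<in> (\<lambda>y. y\<^sup>2) ` {-1<..<0}"
        by blast
    qed (auto simp: abs_square_less_1)
    show "2 * beta_density y = \<bar>2 * y\<bar> * ?f (y\<^sup>2)" if "y \<in> {-1<..<0}" for y
      using that by (intro sq) auto
  qed (auto intro!: derivative_eq_intros inj_onI simp: power2_eq_iff)
  have "((\<lambda>y. 2 * beta_density y) has_integral Beta (1/2) (1/3) + Beta (1/2) (1/3)) ({-1<..<0} \<union> {0<..<1})"
    using L R has_integral_Beta_half_third by (intro has_integral_Un) auto
  then have "((\<lambda>y. 2 * beta_density y) has_integral 2 * Beta (1/2) (1/3)) ({-1<..<0} \<union> {0<..<1})"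
    by simp
  then have "((\<lambda>y. 2 * beta_density y) has_integral 2 * Beta (1/2) (1/3)) {-1<..<1}"
    by (rule iffD1[OF has_integral_spike_set_eq, rotated 2])
       (rule negligible_subset[of "{0}"]; force)+
  from has_integral_mult_right[OF this, of "1/2"] show ?thesis
    by simp
qed

text \<open>The substitution \<open>v = 1 / y^2\<close> produces the Beta integrand with parameters
  1/6 and 1/3, and \<open>Beta_sixth_third\<close> converts its value into that of the inner
  interval.\<close>

lemma has_integral_beta_density_outer: "(beta_density has_integral Beta (1/2) (1/3)) {..<-1}"
proof -
  let ?f = "\<lambda>v::real. v powr (-5/6) * (1 - v) powr (-2/3)"
  have "(?f has_integral Beta (1/6) (1/3)) {0<..<1}"
    using has_integral_Beta_real[of "1/6" "1/3"] by (simp add: has_integral_Icc_iff_Ioo)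
  moreover have "((\<lambda>y. 2 * beta_density y) has_integral Beta (1/6) (1/3)) {..<-1}
      \<longleftrightarrow> (?f has_integral Beta (1/6) (1/3)) {0<..<1}"
  proof (rule has_integral_substitution_nonneg)
    show "(\<lambda>y::real. 1 / y\<^sup>2) ` {..<-1} = {0<..<1}"
    proof (intro equalityI subsetI)
      fix v :: real assume v: "v \<in> {0<..<1}"
      then have "v = 1 / (- 1 / sqrt v)\<^sup>2" "- 1 / sqrt v < -1"
        by (auto simp: power_divide)
      then show "v \<in> (\<lambda>y. 1 / y\<^sup>2) ` {..<-1}"
        by blast
    next
      fix v :: real assume "v \<in> (\<lambda>y. 1 / y\<^sup>2) ` {..<-1}"
      then obtain y :: real where y: "y < -1" "v = 1 / y\<^sup>2"
        by auto
      then have "1 < y\<^sup>2"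
        using one_less_power[of "-y" 2] by simp
      then show "v \<in> {0<..<1}"
        using y by auto
    qed
    show "2 * beta_density y = \<bar>- 2 / y ^ 3\<bar> * ?f (1 / y\<^sup>2)" if "y \<in> {..<-1}" for y
    proof -
      \<comment> \<open>With the positive base \<open>z\<close>, integer powers can be written with
        \<open>powr\<close> and exponents added: the exponents 5/3 and 4/3 combine to cancel the
        Jacobian's \<open>z ^ 3\<close>.\<close>
      define z where "z = - y"
      have z: "z > 1" and y: "y = - z"
        using that by (auto simp: z_def)
      have z2: "z\<^sup>2 > 1"
        using z by (simp add: one_less_power)
      have z_powr: "z\<^sup>2 = z powr 2" "z ^ 3 = z powr 3"
        using z by simp_all
      have "(1 - 1 / z\<^sup>2) powr (-2/3) = ((z\<^sup>2 - 1) / z\<^sup>2) powr (-2/3)"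
        using z by (simp add: diff_divide_distrib)
      also have "\<dots> = (z\<^sup>2 - 1) powr (-2/3) / (z\<^sup>2) powr (-2/3)"
        using z2 by (simp add: powr_divide)
      also have "(z\<^sup>2) powr (-2/3) = z powr (-4/3)"
        unfolding z_powr powr_powr by simp
      also have "(z\<^sup>2 - 1) powr (-2/3) / z powr (-4/3) = (z\<^sup>2 - 1) powr (-2/3) * z powr (4/3)"
        by (simp add: powr_minus_divide)
      finally have 1: "(1 - 1 / z\<^sup>2) powr (-2/3) = (z\<^sup>2 - 1) powr (-2/3) * z powr (4/3)" .
      have "(1 / z\<^sup>2) = z powr (-2)"
        unfolding z_powr by (simp add: powr_minus_divide)
      then have 2: "(1 / z\<^sup>2) powr (-5/6) = z powr (5/3)"
        by (simp only: powr_powr) simp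
      have 3: "z powr (5/3) * z powr (4/3) = z ^ 3"
        unfolding z_powr by (simp flip: powr_add)
      have "\<bar>- 2 / y ^ 3\<bar> * ?f (1 / y\<^sup>2) =
              2 / z ^ 3 * (z powr (5/3) * z powr (4/3)) * (z\<^sup>2 - 1) powr (-2/3)"
        unfolding y power2_minus 1 2 using z by simp
      also have "\<dots> = 2 * beta_density y"
        unfolding 3 y beta_density_def using z z2 by simp
      finally show ?thesis ..
    qed
    show "inj_on (\<lambda>y::real. 1 / y\<^sup>2) {..<-1}"
      by (auto intro!: inj_onI simp: power2_eq_iff)
  qed (auto intro!: derivative_eq_intros simp: field_simps power3_eq_cube power2_eq_square)
  ultimately have "((\<lambda>y. 2 * beta_density y) has_integral 2 * Beta (1/2) (1/3)) {..<-1}"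
    by (simp add: Beta_sixth_third)
  from has_integral_mult_right[OF this, of "1/2"] show ?thesis
    by simp
qed

text \<open>
  The covering arises as follows: at parameter \<open>27/32\<close> the Schwarz-Christoffel quadrilateral of
  the Euler integrand is tiled by ten right triangles belonging to the Beta integral, which prescribes the
  zeros and poles of the map. The condition that \<open>cover\<close> be odd, with
  \<open>cover - 1\<close> and \<open>cover + 1\<close> a linear factor times a cube over the same
  denominator, then determines its coefficients.
\<close>

definition cubA :: "real \<Rightarrow> real" where "cubA w = 27 * w ^ 3 + 9 * w\<^sup>2 + w + 3"
definition cubB :: "real \<Rightarrow> real" where "cubB w = 27 * w ^ 3 - 9 * w\<^sup>2 + w - 3"
definition cover_den :: "real \<Rightarrow> real" where "cover_den w = 128 * w ^ 3 * (27 * w\<^sup>2 + 5)"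
definition cover :: "real \<Rightarrow> real" where "cover w = 1 - (1 - w) * cubA w ^ 3 / cover_den w"
definition cover' :: "real \<Rightarrow> real" where
  "cover' w = 5 / 128 * (cubA w * cubB w)\<^sup>2 / (w\<^sup>2 * (27 * w\<^sup>2 + 5))\<^sup>2"
text \<open>The only real zero of \<open>cubB\<close>; there \<open>cover\<close> takes the value -1
  and the two ranges of integration meet.\<close>

definition cover_root :: real where "cover_root = (1 + root 3 80) / 9"

section \<open>Signs of the factors and position of the values -1 and 1\<close>

lemma cover_den_pos: "w > 0 \<Longrightarrow> cover_den w > 0"
  by (simp add: cover_den_def add_nonneg_pos)

lemma cubA_pos: "w > 0 \<Longrightarrow> cubA w > 0"
  by (simp add: cubA_def add_pos_pos)

text \<open>Completing the cube shows that \<open>cubB\<close> is strictly increasing and yields its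
  zero by a single cube root.\<close>

lemma cubB_eq: "cubB w = ((9 * w - 1) ^ 3 - 80) / 27"
  unfolding cubB_def by (simp add: power3_eq_cube power2_eq_square algebra_simps)

lemma cubB_less_iff: "cubB w < 0 \<longleftrightarrow> w < cover_root" and cubB_gt_iff: "cubB w > 0 \<longleftrightarrow> w > cover_root"
proof -
  have r: "(9 * w - 1) = root 3 ((9 * w - 1) ^ 3)"
    by (simp add: odd_real_root_power_cancel)
  have "cubB w < 0 \<longleftrightarrow> (9 * w - 1) ^ 3 < 80"
    by (simp add: cubB_eq)
  also have "\<dots> \<longleftrightarrow> 9 * w - 1 < root 3 80"
    by (subst (2) r) (simp add: real_root_less_iff)
  finally show "cubB w < 0 \<longleftrightarrow> w < cover_root"
    by (simp add: cover_root_def field_simps)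
  have "cubB w > 0 \<longleftrightarrow> (9 * w - 1) ^ 3 > 80"
    by (simp add: cubB_eq)
  also have "\<dots> \<longleftrightarrow> 9 * w - 1 > root 3 80"
    by (subst (2) r) (simp add: real_root_less_iff)
  finally show "cubB w > 0 \<longleftrightarrow> w > cover_root"
    by (simp add: cover_root_def field_simps)
qed

lemma cover_root_bounds: "1 / 9 < cover_root" "cover_root < 1"
proof -
  \<comment> \<open>The value 8 is \<open>9 * w - 1\<close> at \<open>w = 1\<close>.\<close>
  have "root 3 80 < root 3 (8 ^ 3)"
    by (subst real_root_less_iff) auto
  then show "cover_root < 1"
    by (simp add: cover_root_def odd_real_root_power_cancel del: power_numeral)
  show "1 / 9 < cover_root"
    by (simp add: cover_root_def)
qed

text \<open>Since \<open>cubB w = - cubA (- w)\<close> and \<open>cover_den\<close> is odd, this is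
  the mirror image of the formula for \<open>1 - cover w\<close>; it amounts to the oddness of
  \<open>cover\<close>.\<close>

lemma cover_plus_1:
  assumes "w > 0"
  shows "cover w + 1 = (1 + w) * cubB w ^ 3 / cover_den w"
proof -
  have "2 * cover_den w - (1 - w) * cubA w ^ 3 = (1 + w) * cubB w ^ 3"
    unfolding cover_den_def cubA_def cubB_def by algebra
  then show ?thesis
    using cover_den_pos[OF assms] by (simp add: cover_def field_simps)
qed

lemma cover_less_iff: "w > 0 \<Longrightarrow> cover w < -1 \<longleftrightarrow> w < cover_root"
  and cover_gt_iff: "w > 0 \<Longrightarrow> cover w > -1 \<longleftrightarrow> w > cover_root"
proof -
  assume w: "w > 0"
  have "cover w < -1 \<longleftrightarrow> cover w + 1 < 0" by linarith
  also have "\<dots> \<longleftrightarrow> cubB w < 0"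
    using w cover_den_pos[OF w] by (simp add: cover_plus_1 divide_less_0_iff mult_less_0_iff power_less_zero_eq)
  finally show "cover w < -1 \<longleftrightarrow> w < cover_root" by (simp add: cubB_less_iff)
  have "cover w > -1 \<longleftrightarrow> cover w + 1 > 0" by linarith
  also have "\<dots> \<longleftrightarrow> cubB w > 0"
    using w cover_den_pos[OF w] by (simp add: cover_plus_1 zero_less_divide_iff zero_less_mult_iff zero_less_power_eq)
  finally show "cover w > -1 \<longleftrightarrow> w > cover_root" by (simp add: cubB_gt_iff)
qed

lemma cover_less_1:
  assumes "0 < w" "w < 1"
  shows "cover w < 1"
  using assms cover_den_pos cubA_pos by (simp add: cover_def)

section \<open>Derivative, injectivity and images of the covering\<close>

text \<open>The cubes in \<open>cover - 1\<close> and \<open>cover + 1\<close> force the derivative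
  to vanish doubly at the zeros of \<open>cubA\<close> and \<open>cubB\<close>, which explains the
  square in \<open>cover'\<close>.\<close>

lemma has_field_derivative_cover:
  assumes "w > 0"
  shows "(cover has_field_derivative cover' w) (at w)"
proof -
  let ?A' = "81 * w\<^sup>2 + 18 * w + 1" and ?D' = "128 * (135 * w ^ 4 + 15 * w\<^sup>2)"
  have A: "(cubA has_field_derivative ?A') (at w)"
    unfolding cubA_def[abs_def] by (auto intro!: derivative_eq_intros)
  have D: "(cover_den has_field_derivative ?D') (at w)"
    unfolding cover_den_def[abs_def]
    by (auto intro!: derivative_eq_intros simp: algebra_simps power2_eq_square power3_eq_cube power4_eq_xxxx)
  have N: "((\<lambda>w. (1 - w) * cubA w ^ 3) has_field_derivative
          - 1 * cubA w ^ 3 + (1 - w) * (3 * cubA w ^ 2 * ?A')) (at w)"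
    by (auto intro!: derivative_eq_intros A)
  have "cover_den w \<noteq> 0"
    using cover_den_pos[OF assms] by simp
  from DERIV_diff[OF DERIV_const[of 1] DERIV_divide[OF N D this]]
  have "(cover has_field_derivative
          - ((- 1 * cubA w ^ 3 + (1 - w) * (3 * cubA w ^ 2 * ?A')) * cover_den w
             - (1 - w) * cubA w ^ 3 * ?D') / (cover_den w * cover_den w)) (at w)"
    unfolding cover_def[abs_def] minus_divide_left[symmetric] diff_0 .
  moreover have "- ((- 1 * cubA w ^ 3 + (1 - w) * (3 * cubA w ^ 2 * ?A')) * cover_den w
             - (1 - w) * cubA w ^ 3 * ?D') = 640 * w\<^sup>2 * (cubA w * cubB w)\<^sup>2"
  proof -
    \<comment> \<open>This is the numerator of the quotient rule after removing the factor
      \<open>(cubA w)\<^sup>2\<close>.\<close>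
    have "cubA w * (cover_den w + (1 - w) * ?D') - 3 * (1 - w) * ?A' * cover_den w = 640 * w\<^sup>2 * (cubB w)\<^sup>2"
      unfolding cover_den_def cubA_def cubB_def by algebra
    then show ?thesis
      by algebra
  qed
  moreover have "640 * w\<^sup>2 * (cubA w * cubB w)\<^sup>2 / (cover_den w * cover_den w) = cover' w"
  proof -
    have "640 * w\<^sup>2 * a\<^sup>2 / (128 * w ^ 3 * Q * (128 * w ^ 3 * Q)) = 5 / 128 * a\<^sup>2 / (w\<^sup>2 * Q)\<^sup>2"
      if "Q > 0" for a Q
      using that assms by (simp add: field_simps power2_eq_square power3_eq_cube)
    moreover have "27 * w\<^sup>2 + 5 > 0"
      by (simp add: add_nonneg_pos)
    ultimately show ?thesis
      unfolding cover'_def cover_den_def by blast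
  qed
  ultimately show ?thesis
    by simp
qed

lemma cover'_pos:
  assumes "w > 0" "w \<noteq> cover_root"
  shows "cover' w > 0"
proof -
  have "cubB w \<noteq> 0" "cubA w \<noteq> 0" "27 * w\<^sup>2 + 5 > 0"
    using assms cubB_less_iff[of w] cubB_gt_iff[of w] cubA_pos[of w] by (auto intro: add_nonneg_pos)
  then show ?thesis
    using assms by (simp add: cover'_def)
qed

lemma continuous_on_cover: "0 < a \<Longrightarrow> continuous_on {a..b} cover"
  by (intro continuous_at_imp_continuous_on ballI DERIV_isCont[OF has_field_derivative_cover]) auto

text \<open>The derivative is positive away from \<open>cover_root\<close>, so \<open>cover\<close>
  increases strictly on an interval avoiding that point.\<close>

lemma inj_on_cover:
  assumes "a \<ge> 0" "cover_root \<notin> {a<..<b}"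
  shows "inj_on cover {a<..<b}"
proof (rule strict_mono_on_imp_inj_on, rule strict_mono_onI)
  fix u v assume uv: "u \<in> {a<..<b}" "v \<in> {a<..<b}" "u < v"
  show "cover u < cover v"
  proof (rule DERIV_pos_imp_increasing[OF uv(3)])
    fix w assume "u \<le> w" "w \<le> v"
    then show "\<exists>d. (cover has_field_derivative d) (at w) \<and> d > 0"
      using uv assms has_field_derivative_cover[of w] cover'_pos[of w] by auto
  qed
qed

text \<open>Near 0 the map tends to minus infinity. An explicit point with value at most
  \<open>v\<close>, together with the value -1 at \<open>cover_root\<close>, allows the intermediate
  value theorem.\<close>

lemma image_cover_left: "cover ` {0<..<cover_root} = {..<-1}"
proof (intro equalityI subsetI)
  fix v assume "v \<in> cover ` {0<..<cover_root}"
  then show "v \<in> {..<-1}"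
    by (auto simp: cover_less_iff)
next
  fix v :: real assume v: "v \<in> {..<-1}"
  \<comment> \<open>Chosen so that \<open>v = - 1 / (768 * u)\<close>. The constant is 128 * 6, with
    6 bounding \<open>27 * u\<^sup>2 + 5\<close> for small \<open>u\<close>; thus
    \<open>cover_den u\<close> is at most \<open>768 * u\<close>, while the numerator of
    \<open>cover u + 1\<close> is at most -1.\<close>
  define u where "u = - 1 / (768 * v)"
  have u: "0 < u" "u < 1 / 9" and v_eq: "v = - 1 / (768 * u)"
    using v by (auto simp: u_def field_simps)
  have "u < cover_root"
    using u cover_root_bounds by linarith
  have B: "cubB u ^ 3 \<le> (-1) ^ 3"
  proof (rule power_mono_odd)
    have "(9 * u - 1) ^ 3 < 0"
      using u by (simp add: power_less_zero_eq)
    moreover have "(x - 80) / 27 \<le> -1" if "x < 0" for x :: real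
      using that by simp
    ultimately show "cubB u \<le> -1"
      unfolding cubB_eq by blast
  qed simp
  have numer: "(1 + u) * cubB u ^ 3 \<le> -1"
    using u mult_left_mono[OF B, of "1 + u"] by simp
  have d: "cover_den u \<le> 768 * u"
  proof -
    have "u ^ 2 \<le> 1 / 27"
      using u power_mono[of u "1/9" 2] by (simp add: power2_eq_square)
    then have "u ^ 2 * (27 * u\<^sup>2 + 5) \<le> 1 * 6"
      by (intro mult_mono) auto
    then show ?thesis
      using u mult_left_mono[of "u ^ 2 * (27 * u\<^sup>2 + 5)" 6 "128 * u"]
      by (simp add: cover_den_def power2_eq_square power3_eq_cube mult_ac)
  qed
  have "cover u + 1 \<le> - 1 / cover_den u"
    unfolding cover_plus_1[OF u(1)] using numer less_imp_le[OF cover_den_pos[OF u(1)]] by (rule divide_right_mono)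
  also have "\<dots> \<le> v"
    unfolding v_eq using d u cover_den_pos[of u] by (simp add: frac_le)
  finally have "cover u \<le> v" by simp
  \<comment> \<open>The strict sign criteria exclude both a smaller and a larger value.\<close>
  moreover have "cover cover_root = -1"
    using cover_less_iff[of cover_root] cover_gt_iff[of cover_root] cover_root_bounds by linarith
  ultimately obtain w where "u \<le> w" "w \<le> cover_root" "cover w = v"
    using IVT'[of cover u v cover_root] v u \<open>u < cover_root\<close> continuous_on_cover[of u cover_root] by auto
  then show "v \<in> cover ` {0<..<cover_root}"
    using u v cover_less_iff[of w] by auto
qed

lemma image_cover_right: "cover ` {cover_root<..<1} = {-1<..<1}"
proof (intro equalityI subsetI)
  fix v assume "v \<in> cover ` {cover_root<..<1}"
  then show "v \<in> {-1<..<1}"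
    using cover_root_bounds by (auto simp: cover_gt_iff cover_less_1)
next
  fix v :: real assume v: "v \<in> {-1<..<1}"
  have "cover cover_root = -1"
    using cover_less_iff[of cover_root] cover_gt_iff[of cover_root] cover_root_bounds by linarith
  moreover have "cover 1 = 1"
    by (simp add: cover_def)
  ultimately obtain w where w: "cover_root \<le> w" "w \<le> 1" "cover w = v"
    using IVT'[of cover cover_root v 1] v cover_root_bounds continuous_on_cover[of cover_root 1] by auto
  then have "w \<noteq> cover_root" "w \<noteq> 1"
    using \<open>cover cover_root = -1\<close> \<open>cover 1 = 1\<close> v by auto
  then show "v \<in> cover ` {cover_root<..<1}"
    using w by auto
qed

section \<open>Pullback of the elliptic differential\<close>

text \<open>One has \<open>\<bar>1 - (cover w)\<^sup>2\<bar> = P * M ^ 3\<close> and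
  \<open>cover' w = 10 * M\<^sup>2\<close>. Raising the first to the power -2/3 gives
  \<open>M powr (-2)\<close>, which cancels the factor in the derivative and leaves only
  \<open>P\<close>.\<close>

lemma beta_density_cover:
  assumes "0 < w" "w < 1" "w \<noteq> cover_root"
  shows "10 * ((1 - w\<^sup>2) * (27 * w\<^sup>2 + 5) / 4) powr (-2/3) = \<bar>cover' w\<bar> * beta_density (cover w)"
proof -
  define P where "P = (1 - w\<^sup>2) * (27 * w\<^sup>2 + 5) / 4"
  define M where "M = \<bar>cubA w * cubB w\<bar> / (16 * (w\<^sup>2 * (27 * w\<^sup>2 + 5)))"
  have AB: "cubA w * cubB w \<noteq> 0"
    using assms cubB_less_iff[of w] cubB_gt_iff[of w] cubA_pos[of w] by auto
  have q: "27 * w\<^sup>2 + 5 > 0"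
    by (simp add: add_nonneg_pos)
  have w2: "w\<^sup>2 < 1"
    using assms by (simp add: power_less_one_iff)
  have P: "P > 0" using q w2 by (simp add: P_def)
  have M: "M > 0" using AB q assms by (simp add: M_def)
  have "1 - (cover w)\<^sup>2 = (1 - cover w) * (cover w + 1)"
    by (simp add: power2_eq_square algebra_simps)
  also have "\<dots> = ((1 - w) * cubA w ^ 3 / cover_den w) * ((1 + w) * cubB w ^ 3 / cover_den w)"
    using assms by (simp add: cover_plus_1) (simp add: cover_def)
  also have "\<dots> = (1 - w\<^sup>2) * (cubA w * cubB w) ^ 3 / (cover_den w)\<^sup>2"
    by (simp add: power2_eq_square power_mult_distrib algebra_simps)
  finally have "\<bar>1 - (cover w)\<^sup>2\<bar> = (1 - w\<^sup>2) * \<bar>cubA w * cubB w\<bar> ^ 3 / (cover_den w)\<^sup>2"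
    using w2 by (simp add: abs_mult power_abs)
  also have "\<dots> = P * M ^ 3"
  proof -
    have "r * a ^ 3 / (128 * w ^ 3 * Q)\<^sup>2 = r * Q / 4 * (a / (16 * (w\<^sup>2 * Q))) ^ 3" if "Q > 0" for r a Q
      using that assms by (simp add: power2_eq_square power3_eq_cube mult_ac)
    with q show ?thesis
      by (simp add: P_def M_def cover_den_def)
  qed
  also have "M ^ 3 = M powr 3"
    using M by simp
  finally have "beta_density (cover w) = (P * M powr 3) powr (-2/3)"
    by (simp only: beta_density_def)
  also have "\<dots> = P powr (-2/3) * (M powr 3) powr (-2/3)"
    by (rule powr_mult)
  also have "(M powr 3) powr (-2/3) = M powr (-2)"
    by (simp add: powr_powr)
  finally have "beta_density (cover w) = P powr (-2/3) * M powr (-2)" .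
  moreover have "M powr (-2) = 1 / M\<^sup>2"
    using M by (simp add: powr_minus_divide)
  moreover have "cover' w * (1 / M\<^sup>2) = 10"
  proof -
    have "5 / 128 * a\<^sup>2 / (w\<^sup>2 * Q)\<^sup>2 * (1 / (\<bar>a\<bar> / (16 * (w\<^sup>2 * Q)))\<^sup>2) = 10"
      if "a \<noteq> 0" "Q > 0" for a Q
      using that assms by (simp add: power_divide power_mult_distrib)
    with AB q show ?thesis
      unfolding cover'_def M_def by blast
  qed
  moreover have "cover' w > 0"
    using assms by (intro cover'_pos)
  ultimately have "\<bar>cover' w\<bar> * beta_density (cover w) = 10 * P powr (-2/3)"
    using M by (simp add: field_simps)
  then show ?thesis
    unfolding P_def ..
qed

text \<open>Split at \<open>cover_root\<close>: the left part covers \<open>y < -1\<close>, the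
  right part \<open>-1 < y < 1\<close>, and each contributes the same Beta value. The splitting
  point is a null set.\<close>

lemma has_integral_elliptic:
  "((\<lambda>w::real. 10 * ((1 - w\<^sup>2) * (27 * w\<^sup>2 + 5) / 4) powr (-2/3)) has_integral 2 * Beta (1/2) (1/3)) {0<..<1}"
  (is "(?F has_integral _) _")
proof -
  have "(?F has_integral Beta (1/2) (1/3)) {0<..<cover_root}
      \<longleftrightarrow> (beta_density has_integral Beta (1/2) (1/3)) {..<-1}"
    by (rule has_integral_substitution_nonneg[where g = cover and g' = cover'])
       (use cover_root_bounds in \<open>auto intro!: beta_density_cover
          simp: image_cover_left has_field_derivative_cover inj_on_cover beta_density_nonneg
          simp del: minus_divide_left divide_minus_left\<close>)
  moreover have "(?F has_integral Beta (1/2) (1/3)) {cover_root<..<1}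
      \<longleftrightarrow> (beta_density has_integral Beta (1/2) (1/3)) {-1<..<1}"
    by (rule has_integral_substitution_nonneg[where g = cover and g' = cover'])
       (use cover_root_bounds in \<open>auto intro!: beta_density_cover
          simp: image_cover_right has_field_derivative_cover inj_on_cover beta_density_nonneg
          simp del: minus_divide_left divide_minus_left\<close>)
  ultimately have "(?F has_integral Beta (1/2) (1/3) + Beta (1/2) (1/3)) ({0<..<cover_root} \<union> {cover_root<..<1})"
    using has_integral_beta_density_inner has_integral_beta_density_outer by (intro has_integral_Un) auto
  then have "(?F has_integral Beta (1/2) (1/3) + Beta (1/2) (1/3)) {0<..<1}"
    by (rule iffD1[OF has_integral_spike_set_eq, rotated 2])
       (rule negligible_subset[of "{cover_root}"]; use cover_root_bounds in force)+
  then show ?thesis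
    by simp
qed

section \<open>Evaluation at 27/32\<close>

theorem mainTheorem1:
  shows "hypergeom_2F1 (1/3) (2/3) (5/6) (27/32) = 8/5"
proof -
  have "0 < (5/6 :: real)" "\<bar>27/32 :: real\<bar> < 1"
    by simp_all
  then obtain s :: real where
    s: "(\<lambda>n. pochhammer (1/3) n * pochhammer (2/3) n / (pochhammer (5/6) n * fact n) * (27/32) ^ n) sums s"
    and F: "hypergeom_2F1 (of_real (1/3)) (of_real (2/3)) (of_real (5/6)) (of_real (27/32)) = of_real s"
    by (rule hypergeom_2F1_sums_of_real)
  let ?f = "\<lambda>t::real. t powr (-2/3) * (1 - t) powr (-1/2) * (1 - 27/32 * t) powr (-2/3)"
  \<comment> \<open>The result of \<open>t = 1 - w^2\<close> in Euler's integrand. The factor 8 is 2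
    from the Jacobian times 4 from \<open>(1/8) powr (-2/3)\<close>.\<close>
  let ?G = "\<lambda>w::real. 8 * ((1 - w\<^sup>2) * (27 * w\<^sup>2 + 5) / 4) powr (-2/3)"
  have "(?f has_integral Beta (1/3) (1/2) * s) {0<..<1}"
    using has_integral_Euler_2F1[OF _ _ _ _ _ s] by simp
  moreover have "(?G has_integral Beta (1/3) (1/2) * s) {0<..<1} \<longleftrightarrow> (?f has_integral Beta (1/3) (1/2) * s) {0<..<1}"
  proof (rule has_integral_substitution_nonneg)
    show "(\<lambda>w::real. 1 - w\<^sup>2) ` {0<..<1} = {0<..<1}"
    proof (intro equalityI subsetI)
      fix v :: real assume "v \<in> {0<..<1}"
      then have "v = 1 - (sqrt (1 - v))\<^sup>2" "sqrt (1 - v) \<in> {0<..<1}"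
        by auto
      then show "v \<in> (\<lambda>w. 1 - w\<^sup>2) ` {0<..<1}"
        by blast
    qed (auto simp: power_less_one_iff)
    show "?G w = \<bar>- 2 * w\<bar> * ?f (1 - w\<^sup>2)" if "w \<in> {0<..<1}" for w
    proof -
      have w: "0 < w" "w\<^sup>2 < 1"
        using that by (auto simp: power_less_one_iff)
      have q: "27 * w\<^sup>2 + 5 > 0"
        by (simp add: add_nonneg_pos)
      have e: "(1/8) powr (-2/3) = (4::real)"
      proof -
        have "(1/8) powr (-2/3) = (2 powr (-3)) powr (-2/3 :: real)"
          by (simp add: powr_minus_divide)
        also have "\<dots> = 4"
          by (subst powr_powr) simp
        finally show ?thesis .
      qed
      \<comment> \<open>Splitting 1/32 as 1/4 times 1/8 isolates a factor with a rational power -2/3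
        and keeps the normalization of \<open>has_integral_elliptic\<close>.\<close>
      have "1 - 27/32 * (1 - w\<^sup>2) = (27 * w\<^sup>2 + 5) / 4 * (1/8)"
        by (simp add: field_simps)
      then have "(1 - 27/32 * (1 - w\<^sup>2)) powr (-2/3) = 4 * ((27 * w\<^sup>2 + 5) / 4) powr (-2/3)"
        using q by (simp only: powr_mult e mult_ac)
      moreover have "(w\<^sup>2) powr (-1/2) = 1 / w"
        using w by (simp add: powr_minus_divide powr_half_sqrt)
      moreover have "((1 - w\<^sup>2) * (27 * w\<^sup>2 + 5) / 4) powr (-2/3)
          = (1 - w\<^sup>2) powr (-2/3) * ((27 * w\<^sup>2 + 5) / 4) powr (-2/3)"
        by (simp only: powr_mult flip: times_divide_eq_right)
      ultimately show ?thesis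
        using w by simp
    qed
  qed (auto intro!: derivative_eq_intros inj_onI)
  \<comment> \<open>Rescaling the factor 10 to 8 turns the two copies of the Beta value into 8/5 of
    one.\<close>
  moreover have "(?G has_integral 8/5 * Beta (1/2) (1/3)) {0<..<1}"
    using has_integral_mult_right[OF has_integral_elliptic, of "8/10"] by simp
  ultimately have "Beta (1/3) (1/2) * s = 8/5 * Beta (1/2) (1/3)"
    by (blast intro: has_integral_unique)
  moreover have "Beta (1/2) (1/3 :: real) \<noteq> 0"
    by (auto simp: Beta_def Gamma_eq_zero_iff elim!: nonpos_Ints_cases)
  ultimately have "s = 8/5"
    by (simp add: Beta_commute)
  with F show ?thesis
    by simp
qed

end
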